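(* Let $n,k\ge1$ and let $f:\mathbb{R}^n\to\mathbb{R}^k$ be continuous. Then $f$ is affine linear on $\mathbb{R}^n$ if and only if the complement $\Gamma(f)^c=\mathbb{R}^{n+k}\setminus\Gamma(f)$ of the graph $\Gamma(f)=\{(x,y)\in\mathbb{R}^n\times\mathbb{R}^k: y=f(x)\}$ is a real $(k-1)$-convex set in $\mathbb{R}^{n+k}$.
   Context: Let $N\ge1$, let $\omega\subset\mathbb{R}^N$ be open and $q\in\{0,\dots,N-1\}$. An upper semi-continuous function $u:\omega\to[-\infty,+\infty)$ is real $q$-convex on $\omega$ if for every real $(q+1)$-dimensional affine subspace $\pi$ of $\mathbb{R}^N$, every open Euclidean ball $B$ relatively compact in $\omega$ and every affine linear function $l:\pi\to\mathbb{R}$ with $u\le l$ on $\partial B\cap\pi$, one has $u\le l$ on $\overline{B}\cap\pi$. An open set $\omega\subset\mathbb{R}^N$ is a real $q$-convex set if $x\mapsto-\ln d_2(x,\partial\omega)$ is real $q$-convex on $\omega$, where $d_2(x,\partial\omega)=\inf\{\|x-y\|_2:y\in\partial\omega\}$ is the Euclidean boundary distance ($+\infty$ if $\partial\omega=\emptyset$). *)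

theory Defs
  imports "HOL-Analysis.Analysis"
begin

definition usc_on :: "'a::topological_space set \<Rightarrow> ('a \<Rightarrow> ereal) \<Rightarrow> bool" where
  "usc_on S u \<longleftrightarrow> (\<forall>c. openin (top_of_set S) {x \<in> S. u x < c})"

(* For an affine subspace S, the affine linear functions on S are exactly the restrictions
   to S of a linear map plus a constant; values outside S are irrelevant. *)
definition affine_linear_on :: "'a::real_vector set \<Rightarrow> ('a \<Rightarrow> 'b::real_vector) \<Rightarrow> bool" where
  "affine_linear_on S l \<longleftrightarrow> (\<exists>A b. linear A \<and> (\<forall>x\<in>S. l x = A x + b))"

(* Functions into [-\<infinity>, +\<infinity>) are ereal-valued with u x < \<infinity> on the set in question.
   "B relatively compact in \<omega>" is closure B \<subseteq> \<omega>, closed balls being compact. *)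
definition real_q_convex_on :: "nat \<Rightarrow> 'a::euclidean_space set \<Rightarrow> ('a \<Rightarrow> ereal) \<Rightarrow> bool" where
  "real_q_convex_on q \<omega> u \<longleftrightarrow>
     open \<omega> \<and> q < DIM('a) \<and>
     (\<forall>x\<in>\<omega>. u x < \<infinity>) \<and> usc_on \<omega> u \<and>
     (\<forall>\<pi> a r (l :: 'a \<Rightarrow> real).
        affine \<pi> \<and> aff_dim \<pi> = int q + 1 \<and>
        0 < r \<and> closure (ball a r) \<subseteq> \<omega> \<and>
        affine_linear_on \<pi> l \<and>
        (\<forall>x \<in> frontier (ball a r) \<inter> \<pi>. u x \<le> ereal (l x)) \<longrightarrow>
        (\<forall>x \<in> closure (ball a r) \<inter> \<pi>. u x \<le> ereal (l x)))"

(* Not infdist, which is 0 for the empty set: here the infimum over an empty boundary is \<infinity>. *)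
definition boundary_dist :: "'a::euclidean_space set \<Rightarrow> 'a \<Rightarrow> ereal" where
  "boundary_dist \<omega> x = (INF y\<in>frontier \<omega>. ereal (dist x y))"

(* Logarithm on [0, \<infinity>] with ln 0 = -\<infinity> and ln \<infinity> = \<infinity>
   (the library ln on real has ln 0 = 0). *)
definition ext_ln :: "ereal \<Rightarrow> ereal" where
  "ext_ln d = (if d \<le> 0 then -\<infinity> else if d = \<infinity> then \<infinity> else ereal (ln (real_of_ereal d)))"

definition real_q_convex_set :: "nat \<Rightarrow> 'a::euclidean_space set \<Rightarrow> bool" where
  "real_q_convex_set q \<omega> \<longleftrightarrow>
     open \<omega> \<and> real_q_convex_on q \<omega> (\<lambda>x. - ext_ln (boundary_dist \<omega> x))"

definition fun_graph :: "('a \<Rightarrow> 'b) \<Rightarrow> ('a \<times> 'b) set" where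
  "fun_graph f = {(x, y). y = f x}"

end

theory Submission
  imports Defs
begin

text \<open>
  Write \<open>u = - ln d(\<cdot>, \<Gamma>)\<close> for the exhaustion function of the complement of the graph \<open>\<Gamma>\<close>.

  If \<open>\<Gamma>\<close> is affine, then through every point \<open>x\<close> of a \<open>k\<close>-dimensional affine \<open>\<pi>\<close> there is a line
  in \<open>\<pi>\<close> that is parallel to \<open>\<Gamma>\<close> or meets \<open>\<Gamma>\<close>. Translations along, respectively homotheties
  centred in, \<open>\<Gamma>\<close> show that the distance to \<open>\<Gamma>\<close> is affine on the part of the line on the same side
  as \<open>x\<close>, so \<open>u\<close> is convex there and is controlled by its values on the sphere.

  Conversely, suppose that \<open>f\<close> is not affine on a segment \<open>[a, b]\<close>. Then for some vector \<open>w\<close> the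
  function \<open>w \<bullet> f\<close> minus its linear interpolation along \<open>[a, b]\<close> has a maximum \<open>M > 0\<close> in the
  interior of the segment. The \<open>k\<close>-dimensional discs over \<open>[a, b]\<close> on which \<open>w \<bullet> y\<close> equals the
  interpolation plus \<open>M + \<epsilon>\<close> avoid \<open>\<Gamma>\<close>, their boundaries stay away from \<open>\<Gamma>\<close> uniformly in
  \<open>\<epsilon>\<close>, but they come arbitrarily close to \<open>\<Gamma>\<close> as \<open>\<epsilon> \<rightarrow> 0\<close>. This violates the
  maximum principle for \<open>u\<close>.
\<close>

section \<open>The boundary distance of the complement of a closed set\<close>

lemma ereal_infdist:
  assumes "S \<noteq> {}"
  shows "(INF y\<in>S. ereal (dist x y)) = ereal (infdist x S)"
proof -
  have "bdd_below (dist x ` S)"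
    by (auto intro: bdd_belowI[of _ 0])
  then show ?thesis
    using ereal_Inf'[of "dist x ` S"] assms by (simp add: infdist_notempty image_comp)
qed

text \<open>A closed set with empty interior is its own frontier, hence the boundary of its
  complement. Off a nonempty such set the distance is finite and positive, so \<open>ext_ln\<close>
  takes no infinite value.\<close>

lemma ext_ln_boundary_dist_Compl:
  fixes S :: "'a::euclidean_space set"
  assumes "closed S" "interior S = {}" "S \<noteq> {}" "x \<notin> S"
  shows "- ext_ln (boundary_dist (- S) x) = ereal (- ln (infdist x S))"
proof -
  have "frontier (- S) = S"
    unfolding frontier_complement using assms by (simp add: frontier_def)
  then show ?thesis
    using infdist_pos_not_in_closed[OF assms(1,3,4)] assms(3)
    by (simp add: boundary_dist_def ereal_infdist ext_ln_def)
qed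

lemma usc_on_ereal:
  assumes "open S" "continuous_on S g" "\<And>x. x \<in> S \<Longrightarrow> u x = ereal (g x)"
  shows "usc_on S u"
  unfolding usc_on_def openin_open_eq[OF assms(1)]
proof (intro allI conjI)
  fix c
  have "open (S \<inter> g -` {y. ereal y < c})"
    using assms(1,2) by (intro continuous_open_preimage open_Collect_less continuous_intros)
  moreover have "S \<inter> g -` {y. ereal y < c} = {x \<in> S. u x < c}"
    using assms(3) by auto
  ultimately show "open {x \<in> S. u x < c}" by simp
qed auto

section \<open>Complements of affine subspaces\<close>

text \<open>As \<open>x\<close> moves to \<open>x + r v\<close>, any \<open>z\<close> in
  \<open>S\<close> can follow inside \<open>S\<close>: by translation in the parallel case, by the
  homothety of ratio \<open>1 - r\<close> centred at \<open>x + v\<close> in the other. This bounds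
  the distance by an affine function of \<open>r\<close> with value \<open>dist x z\<close> at
  \<open>r = 0\<close>; the infimum over \<open>z\<close> finishes. The bounds by 1 keep the ratio
  nonnegative.\<close>

lemma infdist_concave_on_line:
  fixes S :: "'a::euclidean_space set"
  assumes S: "affine S" "S \<noteq> {}"
    and v: "(\<forall>z\<in>S. \<forall>t. z + t *\<^sub>R v \<in> S) \<or> x + v \<in> S \<and> s \<le> 1 \<and> t \<le> 1"
    and \<alpha>: "\<alpha> \<ge> 0" "\<mu> \<ge> 0" "\<alpha> + \<mu> = 1" "\<alpha> * s + \<mu> * t = 0"
  shows "\<alpha> * infdist (x + s *\<^sub>R v) S + \<mu> * infdist (x + t *\<^sub>R v) S \<le> infdist x S"
proof -
  have "\<alpha> * infdist (x + s *\<^sub>R v) S + \<mu> * infdist (x + t *\<^sub>R v) S \<le> dist x z" if "z \<in> S" for z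
    using v
  proof
    assume par: "\<forall>z\<in>S. \<forall>t. z + t *\<^sub>R v \<in> S"
    have "infdist (x + r *\<^sub>R v) S \<le> dist x z" for r
      using infdist_le[of "z + r *\<^sub>R v" S "x + r *\<^sub>R v"] par that by simp
    then have "\<alpha> * infdist (x + s *\<^sub>R v) S + \<mu> * infdist (x + t *\<^sub>R v) S \<le> \<alpha> * dist x z + \<mu> * dist x z"
      using \<alpha> by (intro add_mono mult_left_mono) auto
    then show ?thesis
      using \<alpha>(3) by (simp flip: distrib_right)
  next
    assume hit: "x + v \<in> S \<and> s \<le> 1 \<and> t \<le> 1"
    have *: "infdist (x + r *\<^sub>R v) S \<le> (1 - r) * dist x z" if "r \<le> 1" for r
    proof -
      have "(1 - r) *\<^sub>R z + r *\<^sub>R (x + v) \<in> S"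
        using S(1) hit \<open>z \<in> S\<close> by (simp add: affine_alt)
      then have "infdist (x + r *\<^sub>R v) S \<le> dist (x + r *\<^sub>R v) ((1 - r) *\<^sub>R z + r *\<^sub>R (x + v))"
        by (rule infdist_le)
      also have "\<dots> = norm ((1 - r) *\<^sub>R (x - z))"
        by (simp add: dist_norm algebra_simps)
      finally show ?thesis
        using that by (simp add: dist_norm)
    qed
    have "\<alpha> * infdist (x + s *\<^sub>R v) S + \<mu> * infdist (x + t *\<^sub>R v) S
        \<le> \<alpha> * ((1 - s) * dist x z) + \<mu> * ((1 - t) * dist x z)"
      using \<alpha> hit * by (intro add_mono mult_left_mono) auto
    also have "\<dots> = (\<alpha> + \<mu> - (\<alpha> * s + \<mu> * t)) * dist x z"
      by (simp add: algebra_simps)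
    also have "\<dots> = dist x z"
      using \<alpha> by simp
    finally show ?thesis .
  qed
  then show ?thesis
    using S(2) by (subst infdist_notempty[of S x]) (auto intro: cINF_greatest)
qed

text \<open>The direction spaces \<open>V\<close> and \<open>W\<close> have complementary
  dimensions. Either they share a nonzero vector, which gives a parallel line, or they span the
  whole space; then splitting \<open>s - x\<close> along them gives a direction of \<open>T\<close>
  that leads from \<open>x\<close> into \<open>S\<close>.\<close>

lemma affine_parallel_or_meet:
  fixes S T :: "'a::euclidean_space set"
  assumes S: "affine S" "S \<noteq> {}" and T: "affine T" "x \<in> T" "x \<notin> S"
    and dims: "aff_dim S + aff_dim T = DIM('a)"
  obtains v where "v \<noteq> 0" "\<And>t. x + t *\<^sub>R v \<in> T"
    "(\<forall>z\<in>S. \<forall>t. z + t *\<^sub>R v \<in> S) \<or> x + v \<in> S"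
proof -
  obtain s where s: "s \<in> S" using S(2) by auto
  define V where "V = (\<lambda>y. y - s) ` S"
  define W where "W = (\<lambda>y. y - x) ` T"
  have V: "subspace V" and W: "subspace W"
    unfolding V_def W_def using affine_diffs_subspace_subtract S T s by auto
  have inT: "x + t *\<^sub>R v \<in> T" if "v \<in> W" for v t
    using subspace_scale[OF W that, of t] by (auto simp: W_def algebra_simps)
  have inS: "z + t *\<^sub>R v \<in> S" if "v \<in> V" "z \<in> S" for v z t
  proof -
    have "t *\<^sub>R v + (z - s) \<in> V"
      using that V by (intro subspace_add subspace_scale) (auto simp: V_def)
    then show ?thesis by (auto simp: V_def algebra_simps)
  qed
  have dim: "dim V + dim W = DIM('a)"
    using dims aff_dim_subspace[OF V] aff_dim_subspace[OF W]
    by (simp add: V_def W_def aff_dim_translation_eq_subtract)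
  show ?thesis
  proof (cases "V \<inter> W \<subseteq> {0}")
    case False
    then obtain v where "v \<noteq> 0" "v \<in> V" "v \<in> W" by auto
    then show ?thesis using that inT inS by blast
  next
    case True
    then have "dim (V \<inter> W) = 0" by (simp add: dim_eq_0)
    then have "dim {y + z |y z. y \<in> V \<and> z \<in> W} = DIM('a)"
      using dim_sums_Int[OF V W] dim by linarith
    then have "{y + z |y z. y \<in> V \<and> z \<in> W} = UNIV"
      by (simp only: dim_eq_full span_eq_iff[THEN iffD2, OF subspace_sums[OF V W]])
    then obtain y z where yz: "y \<in> V" "z \<in> W" "s - x = y + z"
      by blast
    have "x + z = s + (-1) *\<^sub>R y"
      using yz(3) by (simp add: algebra_simps)
    then have "x + z \<in> S"
      using inS[OF yz(1) s, of "-1"] by simp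
    moreover from this have "z \<noteq> 0" using T(3) by auto
    ultimately show ?thesis using that inT yz(2) by blast
  qed
qed

lemma real_q_convex_set_Compl_affine:
  fixes S :: "'a::euclidean_space set"
  assumes S: "affine S" "S \<noteq> {}" and dim: "aff_dim S + int q + 1 = DIM('a)"
  shows "real_q_convex_set q (- S)"
proof -
  have cl: "closed S"
    using S(1) by (rule affine_closed)
  have int: "interior S = {}"
    using aff_dim_nonempty_interior[of S] dim by force
  define g where "g x = - ln (infdist x S)" for x
  have pos: "infdist x S > 0" if "x \<notin> S" for x
    using infdist_pos_not_in_closed cl S(2) that by blast
  have u: "- ext_ln (boundary_dist (- S) x) = ereal (g x)" if "x \<in> - S" for x
    using ext_ln_boundary_dist_Compl[OF cl int S(2)] that by (simp add: g_def)
  have "continuous_on (- S) g"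
    unfolding g_def by (intro continuous_intros) (use pos in force)
  then have usc: "usc_on (- S) (\<lambda>x. - ext_ln (boundary_dist (- S) x))"
    using cl u by (intro usc_on_ereal) auto
  have max: "g x \<le> l x"
    if \<pi>: "affine \<pi>" "aff_dim \<pi> = int q + 1"
      and r: "r > 0" and sub: "cball a r \<subseteq> - S" and l: "affine_linear_on \<pi> l"
      and bd: "\<And>x. x \<in> sphere a r \<inter> \<pi> \<Longrightarrow> g x \<le> l x" and x: "x \<in> cball a r \<inter> \<pi>"
    for \<pi> a r x and l :: "'a \<Rightarrow> real"
  proof (cases "x \<in> sphere a r")
    case True
    then show ?thesis using bd x by auto
  next
    case False
    then have ball: "x \<in> ball a r" using x by auto
    obtain v where v: "v \<noteq> 0" "\<And>t. x + t *\<^sub>R v \<in> \<pi>"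
      "(\<forall>z\<in>S. \<forall>t. z + t *\<^sub>R v \<in> S) \<or> x + v \<in> S"
      using affine_parallel_or_meet[of S \<pi> x] S \<pi> x sub dim by (auto simp: subset_iff)
    obtain t where t: "t > 0" "x + t *\<^sub>R v \<in> sphere a r"
      using ray_to_frontier[of "ball a r" x v] v(1) ball r by auto
    obtain s where s: "s > 0" "x + s *\<^sub>R (- v) \<in> sphere a r"
      using ray_to_frontier[of "ball a r" x "- v"] v(1) ball r by auto
    \<comment> \<open>These weights express \<open>x\<close> as a convex combination of the two
      points where the line leaves the ball.\<close>
    define \<alpha> where "\<alpha> = t / (s + t)"
    define \<mu> where "\<mu> = s / (s + t)"
    have \<alpha>: "\<alpha> \<ge> 0" "\<mu> \<ge> 0" "\<alpha> + \<mu> = 1" "\<alpha> * (- s) + \<mu> * t = 0"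
      using s t by (auto simp: \<alpha>_def \<mu>_def simp flip: add_divide_distrib)
    define y where "y = x + (- s) *\<^sub>R v"
    define z where "z = x + t *\<^sub>R v"
    have y: "y \<in> sphere a r" "y \<in> \<pi>" and z: "z \<in> sphere a r" "z \<in> \<pi>"
      using s t v(2)[of "- s"] v(2)[of t] by (simp_all add: y_def z_def)
    have yS: "y \<notin> S" and zS: "z \<notin> S"
      using y z sub by (auto simp: subset_iff)
    \<comment> \<open>Were the exit point \<open>z\<close> beyond \<open>x + v\<close>, the ball
      would contain \<open>x + v\<close>, a point of \<open>S\<close>. The other exit point has a
      negative parameter and needs no such check.\<close>
    have side: "(\<forall>z\<in>S. \<forall>t. z + t *\<^sub>R v \<in> S) \<or> (x + v \<in> S \<and> t \<le> 1)"
    proof (rule ccontr)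
      assume "\<not> ?thesis"
      with v(3) have "x + v \<in> S" "t > 1" by auto
      have "x + v = (1 - 1 / t) *\<^sub>R x + (1 / t) *\<^sub>R z"
        using \<open>t > 1\<close> by (simp add: z_def algebra_simps)
      also have "\<dots> \<in> cball a r"
        using convexD[OF convex_cball, of x a r z "1 - 1 / t" "1 / t"] x z \<open>t > 1\<close> by auto
      finally show False using \<open>x + v \<in> S\<close> sub by auto
    qed
    have conc: "\<alpha> * infdist y S + \<mu> * infdist z S \<le> infdist x S"
      unfolding y_def z_def using S side \<alpha> s by (intro infdist_concave_on_line) auto
    have "\<alpha> * ln (infdist y S) + \<mu> * ln (infdist z S) \<le> ln (\<alpha> * infdist y S + \<mu> * infdist z S)"
      using concave_onD[OF ln_concave, of \<mu> "infdist y S" "infdist z S"] \<alpha> pos[OF yS] pos[OF zS]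
      by (simp add: eq_diff_eq[symmetric])
    also have "\<dots> \<le> ln (infdist x S)"
    proof -
      have "\<alpha> * infdist y S + \<mu> * infdist z S > 0"
        using pos[OF yS] pos[OF zS] s t by (auto simp: \<alpha>_def \<mu>_def intro!: add_pos_pos)
      then show ?thesis using conc by simp
    qed
    finally have "g x \<le> \<alpha> * g y + \<mu> * g z"
      by (simp add: g_def)
    also have "\<dots> \<le> \<alpha> * l y + \<mu> * l z"
      using bd y z \<alpha> by (intro add_mono mult_left_mono) auto
    also have "\<dots> = l x"
    proof -
      obtain A c where A: "linear A" "\<And>x. x \<in> \<pi> \<Longrightarrow> l x = A x + c"
        using l by (auto simp: affine_linear_on_def)
      have "\<alpha> * l y + \<mu> * l z = A (\<alpha> *\<^sub>R y + \<mu> *\<^sub>R z) + (\<alpha> + \<mu>) * c"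
        using A y z by (simp add: linear_add linear_scale algebra_simps)
      also have "\<alpha> *\<^sub>R y + \<mu> *\<^sub>R z = (\<alpha> + \<mu>) *\<^sub>R x + (\<alpha> * (- s) + \<mu> * t) *\<^sub>R v"
        by (simp add: y_def z_def algebra_simps)
      finally show ?thesis using A(2) x \<alpha> by simp
    qed
    finally show ?thesis .
  qed
  have "real_q_convex_on q (- S) (\<lambda>x. - ext_ln (boundary_dist (- S) x))"
    unfolding real_q_convex_on_def
  proof (intro conjI allI impI ballI)
    show "open (- S)" using cl by auto
    have "aff_dim S \<ge> 0"
      using S(2) aff_dim_geq[of S] aff_dim_empty[of S] by linarith
    then show "q < DIM('a)" using dim by linarith
  next
    fix x assume "x \<in> - S" then show "- ext_ln (boundary_dist (- S) x) < \<infinity>" by (simp add: u)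
  next
    fix \<pi> a r l x
    assume A: "affine \<pi> \<and> aff_dim \<pi> = int q + 1 \<and> 0 < r \<and> closure (ball a r) \<subseteq> - S \<and>
        affine_linear_on \<pi> l \<and>
        (\<forall>x\<in>frontier (ball a r) \<inter> \<pi>. - ext_ln (boundary_dist (- S) x) \<le> ereal (l x))"
      and x: "x \<in> closure (ball a r) \<inter> \<pi>"
    then have sub: "cball a r \<subseteq> - S" by auto
    have "g x \<le> l x"
    proof (rule max[where \<pi> = \<pi> and a = a and r = r])
      fix y assume y: "y \<in> sphere a r \<inter> \<pi>"
      then have "y \<in> - S" using sub by (auto simp: subset_iff)
      moreover have "- ext_ln (boundary_dist (- S) y) \<le> ereal (l y)"
        using A y by (simp del: ereal_uminus_le_reorder)
      ultimately show "g y \<le> l y" by (simp add: u)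
    qed (use A x in auto)
    then show "- ext_ln (boundary_dist (- S) x) \<le> ereal (l x)"
      using u sub A x by (auto simp: subset_iff)
  qed (fact usc)
  then show ?thesis
    using cl by (auto simp: real_q_convex_set_def)
qed

section \<open>The maximum principle\<close>

lemma real_q_convex_onD:
  assumes "real_q_convex_on q \<omega> u" "affine \<pi>" "aff_dim \<pi> = int q + 1"
    and "0 < r" "closure (ball a r) \<subseteq> \<omega>" "affine_linear_on \<pi> l"
    and "\<forall>x\<in>frontier (ball a r) \<inter> \<pi>. u x \<le> ereal (l x)"
  shows "\<forall>x\<in>closure (ball a r) \<inter> \<pi>. u x \<le> ereal (l x)"
  by (rule assms(1)[unfolded real_q_convex_on_def, THEN conjunct2, THEN conjunct2, THEN conjunct2,
        THEN conjunct2, THEN spec, THEN spec, THEN spec, THEN spec, THEN mp])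
     (intro conjI assms)

text \<open>Passing from round balls to arbitrary compact sets: a maximum of \<open>g + \<epsilon> \<parallel>\<cdot>\<parallel>\<^sup>2\<close> in the relative
  interior would violate convexity on a small ball, with the tangent function as \<open>l\<close>.\<close>

lemma real_q_convex_on_max_principle:
  fixes g :: "'a::euclidean_space \<Rightarrow> real"
  assumes conv: "real_q_convex_on q \<omega> u" and g: "continuous_on \<omega> g" "\<And>x. x \<in> \<omega> \<Longrightarrow> u x = ereal (g x)"
    and \<pi>: "affine \<pi>" "aff_dim \<pi> = int q + 1"
    and K: "compact K" "K \<subseteq> \<omega>" "K \<subseteq> \<pi>" and U: "open U" "U \<inter> \<pi> \<subseteq> K"
    and bd: "\<And>x. x \<in> K - U \<Longrightarrow> g x \<le> c" and x: "x \<in> K"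
  shows "g x \<le> c"
proof (rule ccontr)
  assume "\<not> g x \<le> c"
  obtain M where M: "M > 0" "\<And>y. y \<in> K \<Longrightarrow> norm y \<le> M"
    using compact_imp_bounded[OF K(1)] by (auto simp: bounded_pos)
  \<comment> \<open>With this choice the perturbation is at most half of the gap
    \<open>g x - c\<close> on \<open>K\<close>.\<close>
  define \<epsilon> where "\<epsilon> = (g x - c) / (2 * M\<^sup>2)"
  have \<epsilon>: "\<epsilon> > 0" "c + \<epsilon> * M\<^sup>2 < g x"
    using M(1) \<open>\<not> g x \<le> c\<close> by (auto simp: \<epsilon>_def field_simps)
  have "continuous_on K (\<lambda>y. g y + \<epsilon> * (norm y)\<^sup>2)"
    using continuous_on_subset[OF g(1) K(2)] by (intro continuous_intros)
  then obtain z where z: "z \<in> K" "\<And>y. y \<in> K \<Longrightarrow> g y + \<epsilon> * (norm y)\<^sup>2 \<le> g z + \<epsilon> * (norm z)\<^sup>2"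
    using continuous_attains_sup[OF K(1)] x by fastforce
  have "z \<in> U"
  proof (rule ccontr)
    assume "z \<notin> U"
    then have "g z + \<epsilon> * (norm z)\<^sup>2 \<le> c + \<epsilon> * M\<^sup>2"
      using bd[of z] z(1) M \<epsilon> by (intro add_mono mult_left_mono power_mono) auto
    also have "\<dots> < g x + \<epsilon> * (norm x)\<^sup>2"
      using \<epsilon> by (smt (verit) mult_nonneg_nonneg zero_le_power2)
    finally show False using z(2)[OF x] by simp
  qed
  have "open \<omega>" using conv by (simp add: real_q_convex_on_def)
  then obtain r where r: "r > 0" "cball z r \<subseteq> \<omega> \<inter> U"
    using U(1) \<open>z \<in> U\<close> z(1) K(2) by (metis IntI open_Int open_contains_cball subsetD)
  have sub: "closure (ball z r) \<subseteq> \<omega>" using r by simp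
  \<comment> \<open>Maximality at \<open>z\<close> bounds \<open>g y\<close> by
    \<open>g z + \<epsilon> (|z|^2 - |y|^2)\<close>. On the sphere \<open>|y - z| = r\<close> this
    bound is exactly \<open>l y\<close>, while at the centre \<open>l z\<close> is smaller than
    \<open>g z\<close> by \<open>\<epsilon> r^2\<close>.\<close>
  define l where "l y = g z - 2 * \<epsilon> * (z \<bullet> (y - z)) - \<epsilon> * r\<^sup>2" for y
  have "affine_linear_on \<pi> l"
    unfolding affine_linear_on_def
  proof (intro exI conjI ballI)
    show "linear (\<lambda>y. - (2 * \<epsilon>) * (z \<bullet> y))"
      by (intro linearI) (auto simp: algebra_simps)
    show "l y = - (2 * \<epsilon>) * (z \<bullet> y) + (g z + 2 * \<epsilon> * (z \<bullet> z) - \<epsilon> * r\<^sup>2)" for y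
      by (simp add: l_def algebra_simps)
  qed
  moreover have "\<forall>y\<in>frontier (ball z r) \<inter> \<pi>. u y \<le> ereal (l y)"
  proof
    fix y assume "y \<in> frontier (ball z r) \<inter> \<pi>"
    then have y: "norm (y - z) = r" "y \<in> \<pi>"
      using r by (auto simp: dist_norm norm_minus_commute)
    have mem: "y \<in> cball z r" using y by (simp add: dist_norm norm_minus_commute)
    then have "y \<in> K" using r U(2) y by auto
    have "(norm y)\<^sup>2 - (norm z)\<^sup>2 = 2 * (z \<bullet> (y - z)) + (norm (y - z))\<^sup>2"
      by (simp add: power2_norm_eq_inner algebra_simps inner_commute)
    then have "\<epsilon> * ((norm y)\<^sup>2 - (norm z)\<^sup>2) = \<epsilon> * (2 * (z \<bullet> (y - z)) + r\<^sup>2)"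
      using y(1) by simp
    then have "g y \<le> l y"
      using z(2)[OF \<open>y \<in> K\<close>] unfolding l_def by (simp add: right_diff_distrib distrib_left)
    then show "u y \<le> ereal (l y)"
      using g(2) mem r by auto
  qed
  ultimately have "\<forall>y\<in>closure (ball z r) \<inter> \<pi>. u y \<le> ereal (l y)"
    by (rule real_q_convex_onD[OF conv \<pi> r(1) sub])
  then have "u z \<le> ereal (l z)"
    using z(1) K(3) r(1) by auto
  then have "g z \<le> l z"
    using g(2) z(1) K(2) by auto
  moreover have "\<epsilon> * r\<^sup>2 > 0" using \<epsilon>(1) r(1) by simp
  ultimately show False
    by (simp add: l_def)
qed

section \<open>Graphs\<close>

lemma closed_fun_graph:
  fixes f :: "'a::t2_space \<Rightarrow> 'b::t2_space"
  assumes "continuous_on UNIV f"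
  shows "closed (fun_graph f)"
  unfolding fun_graph_def case_prod_unfold
  by (intro closed_Collect_eq continuous_intros continuous_on_compose2[OF assms]) auto

lemma interior_fun_graph:
  fixes f :: "'a::euclidean_space \<Rightarrow> 'b::euclidean_space"
  shows "interior (fun_graph f) = {}"
proof (rule ccontr)
  assume "interior (fun_graph f) \<noteq> {}"
  then obtain x y r where r: "r > 0" "ball (x, y) r \<subseteq> fun_graph f"
    by (metis ex_in_conv mem_interior surj_pair)
  obtain e :: 'b where e: "norm e = r / 2"
    using vector_choose_size[of "r / 2"] r(1) by auto
  have "(x, y) \<in> ball (x, y) r" "(x, y + e) \<in> ball (x, y) r"
    using r(1) e by (auto simp: dist_Pair_Pair dist_norm)
  with r(2) have "(x, y) \<in> fun_graph f" "(x, y + e) \<in> fun_graph f"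
    by blast+
  then show False using e r(1) by (auto simp: fun_graph_def)
qed

text \<open>After subtracting \<open>f 0\<close>, segments from 0 give homogeneity for factors in
  [0,1], rescaling by \<open>1 / t\<close> extends it to larger factors, and doubled midpoints give
  additivity, hence also negative factors.\<close>

lemma affine_linear_onI_segment:
  fixes f :: "'a::real_vector \<Rightarrow> 'b::real_vector"
  assumes f: "\<And>x y t. 0 \<le> t \<Longrightarrow> t \<le> 1 \<Longrightarrow> f ((1 - t) *\<^sub>R x + t *\<^sub>R y) = (1 - t) *\<^sub>R f x + t *\<^sub>R f y"
  shows "affine_linear_on UNIV f"
proof -
  define g where "g x = f x - f 0" for x
  have seg: "g ((1 - t) *\<^sub>R x + t *\<^sub>R y) = (1 - t) *\<^sub>R g x + t *\<^sub>R g y" if "0 \<le> t" "t \<le> 1" for x y t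
    using f[OF that, of x y] by (simp add: g_def algebra_simps)
  have [simp]: "g 0 = 0" by (simp add: g_def)
  have small: "g (t *\<^sub>R y) = t *\<^sub>R g y" if "0 \<le> t" "t \<le> 1" for y t
    using seg[OF that, of 0 y] by simp
  have pos: "g (t *\<^sub>R y) = t *\<^sub>R g y" if "0 \<le> t" for y t
  proof (cases "t \<le> 1")
    case False
    then have "g ((1 / t) *\<^sub>R (t *\<^sub>R y)) = (1 / t) *\<^sub>R g (t *\<^sub>R y)"
      by (intro small) auto
    then show ?thesis using False by simp
  qed (use small that in auto)
  have add: "g (x + y) = g x + g y" for x y
  proof -
    have "g (2 *\<^sub>R ((1 - 1 / 2) *\<^sub>R x + (1 / 2) *\<^sub>R y)) = 2 *\<^sub>R ((1 - 1 / 2) *\<^sub>R g x + (1 / 2) *\<^sub>R g y)"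
      by (subst pos, simp, subst seg) auto
    then show ?thesis by (simp add: scaleR_add_right)
  qed
  have neg: "g (- x) = - g x" for x
    using add[of x "- x"] by (simp add: eq_neg_iff_add_eq_0 add.commute)
  have "g (t *\<^sub>R y) = t *\<^sub>R g y" for t y
    using pos[of t y] pos[of "- t" y] neg[of "t *\<^sub>R y"] by (cases "t \<ge> 0") auto
  then have "linear g"
    using add by (intro linearI)
  then show ?thesis
    unfolding affine_linear_on_def by (intro exI[of _ g] exI[of _ "f 0"]) (simp add: g_def)
qed

text \<open>The graph is a translate of the image of the injective linear map
  \<open>x \<mapsto> (x, A x)\<close>, so its dimension is that of the domain and the case of affine
  subspaces applies.\<close>

lemma real_q_convex_set_Compl_graph_affine:
  fixes f :: "'a::euclidean_space \<Rightarrow> 'b::euclidean_space"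
  assumes "affine_linear_on UNIV f"
  shows "real_q_convex_set (DIM('b) - 1) (- fun_graph f)"
proof -
  obtain A b where A: "linear A" and f: "\<And>x. f x = A x + b"
    using assms by (auto simp: affine_linear_on_def)
  define V where "V = (\<lambda>x. (x, A x)) ` UNIV"
  have lin: "linear (\<lambda>x. (x, A x))"
    using A by (intro linearI) (auto simp: linear_add linear_scale)
  have V: "subspace V"
    unfolding V_def using lin by (intro linear_subspace_image subspace_UNIV)
  have graph: "fun_graph f = (+) (0, b) ` V"
    by (force simp: fun_graph_def V_def f image_iff add.commute)
  have "dim V = DIM('a)"
    unfolding V_def using dim_image_eq[OF lin, of UNIV] by (simp add: inj_on_def)
  then have "aff_dim (fun_graph f) = int DIM('a)"
    by (simp add: graph aff_dim_translation_eq aff_dim_subspace V)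
  moreover have "affine (fun_graph f)"
    unfolding graph using V affine_translation subspace_imp_affine by blast
  moreover have "fun_graph f \<noteq> {}"
    by (auto simp: fun_graph_def)
  moreover have "DIM('b) \<ge> 1" by (simp add: Suc_leI)
  ultimately show ?thesis
    by (intro real_q_convex_set_Compl_affine) auto
qed

section \<open>From convexity of the complement to affinity of the map\<close>

text \<open>These are the test subspaces lying over a line. Each is a translate of an injective
  linear image of the product of the real line and the hyperplane orthogonal to
  \<open>w\<close>.\<close>

lemma aff_dim_tilted:
  fixes v p :: "'a::euclidean_space" and d w q :: "'b::euclidean_space"
  assumes "v \<noteq> 0" "w \<noteq> 0"
  defines "\<pi> \<equiv> {(p + t *\<^sub>R v, q + t *\<^sub>R d + h) |t h. w \<bullet> h = 0}"
  shows "affine \<pi>" "aff_dim \<pi> = DIM('b)"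
proof -
  define F where "F = (\<lambda>(t :: real, h). (t *\<^sub>R v, t *\<^sub>R d + h))"
  define D where "D = (UNIV :: real set) \<times> {h. w \<bullet> h = 0}"
  have lin: "linear F"
    unfolding F_def by (intro linearI) (auto simp: algebra_simps)
  have D: "subspace D"
    unfolding D_def by (intro subspace_Times subspace_UNIV subspace_hyperplane)
  then have FD: "subspace (F ` D)"
    using lin by (rule linear_subspace_image[rotated])
  have \<pi>: "\<pi> = (+) (p, q) ` F ` D"
    by (force simp: \<pi>_def F_def D_def image_iff add.assoc)
  show "affine \<pi>"
    unfolding \<pi> using FD affine_translation subspace_imp_affine by blast
  have "inj F"
    using assms(1) by (auto simp: F_def inj_on_def)
  then have "dim (F ` D) = dim D"
    using dim_image_eq[OF lin] inj_on_subset by blast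
  also have "\<dots> = 1 + (DIM('b) - 1)"
    unfolding D_def using assms(2)
    by (subst dim_Times) (auto simp: subspace_hyperplane dim_hyperplane)
  also have "\<dots> = DIM('b)" by (simp add: Suc_leI)
  finally show "aff_dim \<pi> = DIM('b)"
    by (simp add: \<pi> aff_dim_translation_eq aff_dim_subspace FD)
qed

lemma affine_linear_on_if_real_q_convex_set_Compl_graph:
  fixes f :: "'a::euclidean_space \<Rightarrow> 'b::euclidean_space"
  assumes cont: "continuous_on UNIV f" and conv: "real_q_convex_set (DIM('b) - 1) (- fun_graph f)"
  shows "affine_linear_on UNIV f"
proof (rule affine_linear_onI_segment, rule ccontr)
  fix a b :: 'a and t :: real
  assume t: "0 \<le> t" "t \<le> 1" and neq: "f ((1 - t) *\<^sub>R a + t *\<^sub>R b) \<noteq> (1 - t) *\<^sub>R f a + t *\<^sub>R f b"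
  define v where "v = b - a"
  define d where "d = f b - f a"
  \<comment> \<open>Testing against the defect itself makes \<open>\<delta> t\<close> equal to
    \<open>w \<bullet> w\<close>, hence positive.\<close>
  define w where "w = f (a + t *\<^sub>R v) - (f a + t *\<^sub>R d)"
  have "w \<noteq> 0"
    using neq by (simp add: w_def v_def d_def algebra_simps)
  then have "v \<noteq> 0" by (auto simp: w_def v_def d_def)
  define \<delta> where "\<delta> s = w \<bullet> (f (a + s *\<^sub>R v) - (f a + s *\<^sub>R d))" for s
  have cf: "continuous_on A (\<lambda>x. f (h x))" if "continuous_on A h" for A and h :: "'c::topological_space \<Rightarrow> 'a"
    using continuous_on_compose2[OF cont that] by simp
  have "continuous_on {0..1} \<delta>"
    unfolding \<delta>_def by (intro continuous_intros cf)
  then obtain m where m: "m \<in> {0..1}" "\<And>s. s \<in> {0..1} \<Longrightarrow> \<delta> s \<le> \<delta> m"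
    using continuous_attains_sup[of "{0..1}" \<delta>] by fastforce
  define M where "M = \<delta> m"
  have "\<delta> t > 0" using \<open>w \<noteq> 0\<close> by (simp add: \<delta>_def w_def[symmetric])
  then have "M > 0" using m(2)[of t] t by (auto simp: M_def)
  have "compact ((\<lambda>s. f (a + s *\<^sub>R v)) ` {0..1})"
    by (intro compact_continuous_image continuous_intros cf) auto
  then obtain R0 where R0: "\<And>s. s \<in> {0..1} \<Longrightarrow> norm (f (a + s *\<^sub>R v)) \<le> R0"
    by (force simp: bounded_iff dest: compact_imp_bounded)
  \<comment> \<open>The extra 1 keeps the graph off the lateral side of the cylinder and leaves room
    for the point \<open>p\<close> below.\<close>
  define R where "R = R0 + 1"
  define \<tau> where "\<tau> x = (x - a) \<bullet> v / (v \<bullet> v)" for x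
  have \<tau>: "\<tau> (a + s *\<^sub>R v) = s" for s
    using \<open>v \<noteq> 0\<close> by (simp add: \<tau>_def)
  have \<tau>_cont: "continuous_on A (\<lambda>z. \<tau> (h z))" if "continuous_on A h" for A and h :: "'a \<times> 'b \<Rightarrow> 'a"
    unfolding \<tau>_def using that \<open>v \<noteq> 0\<close> by (intro continuous_intros) auto
  define cyl where "cyl = (\<lambda>s. a + s *\<^sub>R v) ` {0..1} \<times> cball (0 :: 'b) R"
  have cyl: "compact cyl"
    unfolding cyl_def by (intro compact_Times compact_continuous_image continuous_intros) auto
  have cylE: "\<exists>s y. z = (a + s *\<^sub>R v, y) \<and> s \<in> {0..1} \<and> norm y \<le> R" if "z \<in> cyl" for z
    using that unfolding cyl_def by (elim SigmaE imageE) (metis mem_cball_0)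
  define side where "side = {z :: 'a \<times> 'b. (\<tau> (fst z) = 0 \<or> \<tau> (fst z) = 1) \<or> norm (snd z) = R}"
  define above where "above = {z :: 'a \<times> 'b. w \<bullet> (f a + \<tau> (fst z) *\<^sub>R d) + M \<le> w \<bullet> snd z}"
  \<comment> \<open>\<open>Z\<close> does not depend on \<open>\<epsilon>\<close> but contains the
    boundaries of all the discs, so its distance from the graph is a uniform gap
    \<open>\<eta>\<close>.\<close>
  define Z where "Z = cyl \<inter> (side \<inter> above)"
  have "closed side" "closed above"
    unfolding side_def above_def
    by (intro closed_Collect_disj closed_Collect_eq closed_Collect_le continuous_intros \<tau>_cont)+
  then have "compact Z"
    unfolding Z_def using cyl by (intro compact_Int_closed closed_Int)
  moreover have \<Gamma>: "closed (fun_graph f)"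
    using cont by (rule closed_fun_graph)
  moreover have "Z \<inter> fun_graph f = {}"
  proof (rule ccontr)
    assume "Z \<inter> fun_graph f \<noteq> {}"
    then obtain z where z: "z \<in> cyl" "z \<in> side \<inter> above" "z \<in> fun_graph f"
      by (auto simp: Z_def)
    then obtain s where "s \<in> {0..1}" "z = (a + s *\<^sub>R v, f (a + s *\<^sub>R v))"
      using cylE[of z] by (auto simp: fun_graph_def)
    then have s: "s \<in> {0..1}" "(a + s *\<^sub>R v, f (a + s *\<^sub>R v)) \<in> side \<inter> above"
      using z(2) by auto
    \<comment> \<open>The lateral side is excluded by \<open>R0 < R\<close>. At the ends of the
      segment the defect is 0, which is below \<open>M\<close>.\<close>
    then have "s = 0 \<or> s = 1"
      using R0[of s] by (auto simp: side_def \<tau> R_def)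
    then have "w \<bullet> f (a + s *\<^sub>R v) = w \<bullet> (f a + s *\<^sub>R d)"
      by (auto simp: d_def v_def)
    then show False using s(2) \<open>M > 0\<close> by (simp add: above_def \<tau>)
  qed
  ultimately obtain \<eta> where \<eta>: "\<eta> > 0" "\<And>y z. y \<in> Z \<Longrightarrow> z \<in> fun_graph f \<Longrightarrow> \<eta> \<le> dist y z"
    using separate_compact_closed by metis
  \<comment> \<open>The second bound brings \<open>p\<close> closer to the graph than
    \<open>\<eta>\<close>; the third keeps \<open>p\<close> inside the cylinder.\<close>
  obtain \<epsilon> where \<epsilon>: "0 < \<epsilon>" "\<epsilon> < \<eta> * norm w" "\<epsilon> \<le> norm w"
    using \<open>w \<noteq> 0\<close> \<eta>(1) by (rule_tac that[of "min (\<eta> * norm w / 2) (norm w)"]) (auto simp: min_def)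
  define \<pi> where "\<pi> = {(a + s *\<^sub>R v, (f a + ((M + \<epsilon>) / (w \<bullet> w)) *\<^sub>R w) + s *\<^sub>R d + h) |s h. w \<bullet> h = 0}"
  have \<pi>: "affine \<pi>" "aff_dim \<pi> = DIM('b)"
    using aff_dim_tilted[OF \<open>v \<noteq> 0\<close> \<open>w \<noteq> 0\<close>] by (auto simp: \<pi>_def)
  have \<pi>_iff: "(a + s *\<^sub>R v, y) \<in> \<pi> \<longleftrightarrow> w \<bullet> y = w \<bullet> (f a + s *\<^sub>R d) + M + \<epsilon>" for s y
  proof
    assume "w \<bullet> y = w \<bullet> (f a + s *\<^sub>R d) + M + \<epsilon>"
    then show "(a + s *\<^sub>R v, y) \<in> \<pi>"
      unfolding \<pi>_def using \<open>w \<noteq> 0\<close>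
      by (intro CollectI exI[of _ s]
            exI[of _ "y - ((f a + ((M + \<epsilon>) / (w \<bullet> w)) *\<^sub>R w) + s *\<^sub>R d)"])
         (auto simp: inner_diff_right inner_add_right)
  qed (use \<open>v \<noteq> 0\<close> \<open>w \<noteq> 0\<close> in \<open>auto simp: \<pi>_def inner_add_right\<close>)
  have \<pi>_fst: "fst z = a + \<tau> (fst z) *\<^sub>R v" if "z \<in> \<pi>" for z
    using that by (auto simp: \<pi>_def \<tau>)
  define K where "K = cyl \<inter> \<pi>"
  \<comment> \<open>\<open>U\<close> is open in the full space; only its trace on
    \<open>\<pi>\<close>, which lies over the line, has to be in the disc \<open>K\<close>.\<close>
  define U where "U = {z :: 'a \<times> 'b. (0 < \<tau> (fst z) \<and> \<tau> (fst z) < 1) \<and> norm (snd z) < R}"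
  define g where "g z = - ln (infdist z (fun_graph f))" for z
  have ne: "fun_graph f \<noteq> {}" by (auto simp: fun_graph_def)
  have pos: "infdist z (fun_graph f) > 0" if "z \<in> - fun_graph f" for z
    using infdist_pos_not_in_closed \<Gamma> ne that by blast
  have K: "K \<subseteq> - fun_graph f"
  proof
    fix z assume "z \<in> K"
    then have "z \<in> cyl" and z\<pi>: "z \<in> \<pi>"
      by (auto simp: K_def)
    then obtain s y where z: "z = (a + s *\<^sub>R v, y)" "s \<in> {0..1}"
      using cylE by blast
    have "w \<bullet> f (a + s *\<^sub>R v) < w \<bullet> y"
      using z z\<pi> \<pi>_iff[of s y] m(2)[of s] \<epsilon>(1) by (simp add: M_def \<delta>_def inner_diff_right)
    then show "z \<in> - fun_graph f" by (auto simp: fun_graph_def z)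
  qed
  \<comment> \<open>Over the maximum point \<open>m\<close> the graph is lowest beneath the disc:
    raising it by \<open>\<epsilon>\<close> in the \<open>w\<close> component reaches
    \<open>\<pi>\<close>, at distance only \<open>\<epsilon> / norm w\<close>.\<close>
  define p where "p = (a + m *\<^sub>R v, f (a + m *\<^sub>R v) + (\<epsilon> / (w \<bullet> w)) *\<^sub>R w)"
  have nw: "norm ((\<epsilon> / (w \<bullet> w)) *\<^sub>R w) = \<epsilon> / norm w"
    using \<epsilon>(1) by (simp add: dot_square_norm power2_eq_square)
  have "p \<in> K"
  proof -
    have "\<epsilon> / norm w \<le> 1"
      using \<epsilon>(3) \<open>w \<noteq> 0\<close> by simp
    then have "norm (snd p) \<le> R0 + 1"
      unfolding p_def snd_conv
      using R0[OF m(1)] by (intro norm_triangle_le add_mono) (simp_all only: nw)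
    moreover have "p \<in> \<pi>"
      unfolding p_def \<pi>_iff using \<open>w \<noteq> 0\<close> by (simp add: M_def \<delta>_def inner_add_right inner_diff_right)
    ultimately show ?thesis
      using m(1) by (auto simp: K_def cyl_def p_def R_def)
  qed
  have "g p \<le> - ln \<eta>"
  proof (rule real_q_convex_on_max_principle[where \<pi> = \<pi> and K = K and U = U])
    show "real_q_convex_on (DIM('b) - 1) (- fun_graph f) (\<lambda>x. - ext_ln (boundary_dist (- fun_graph f) x))"
      using conv by (simp add: real_q_convex_set_def)
    show "- ext_ln (boundary_dist (- fun_graph f) z) = ereal (g z)" if "z \<in> - fun_graph f" for z
      using ext_ln_boundary_dist_Compl[OF \<Gamma> interior_fun_graph ne] that by (simp add: g_def)
    show "continuous_on (- fun_graph f) g"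
      unfolding g_def by (intro continuous_intros) (use pos in force)
    show "aff_dim \<pi> = int (DIM('b) - 1) + 1"
      using \<pi>(2) by (simp add: Suc_leI of_nat_diff)
    show "compact K"
      unfolding K_def using cyl affine_closed[OF \<pi>(1)] by (rule compact_Int_closed)
    show "open U"
      unfolding U_def by (intro open_Collect_conj open_Collect_less continuous_intros \<tau>_cont)
    show "U \<inter> \<pi> \<subseteq> K"
    proof
      fix z assume z: "z \<in> U \<inter> \<pi>"
      then have "fst z \<in> (\<lambda>s. a + s *\<^sub>R v) ` {0..1}"
        using \<pi>_fst[of z] by (intro image_eqI[of _ _ "\<tau> (fst z)"]) (auto simp: U_def)
      then show "z \<in> K"
        using z by (auto simp: K_def cyl_def U_def mem_Times_iff)
    qed
    show "g z \<le> - ln \<eta>" if "z \<in> K - U" for z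
    proof -
      have "z \<in> cyl" and z\<pi>: "z \<in> \<pi>"
        using that by (auto simp: K_def)
      then obtain s y where z: "z = (a + s *\<^sub>R v, y)" "s \<in> {0..1}" "norm y \<le> R"
        using cylE by blast
      then have "z \<in> Z"
        using that z\<pi> \<pi>_iff[of s y] \<epsilon>(1) by (auto simp: Z_def K_def side_def above_def U_def \<tau>)
      then have "\<eta> \<le> infdist z (fun_graph f)"
        unfolding infdist_notempty[OF ne] using \<eta>(2) by (intro cINF_greatest[OF ne])
      then show ?thesis using \<eta>(1) by (simp add: g_def)
    qed
  qed (use \<pi> K \<open>p \<in> K\<close> in \<open>auto simp: K_def\<close>)
  \<comment> \<open>The maximum principle carries the gap \<open>\<eta>\<close> from the rim of the
    disc to \<open>p\<close>, contradicting the choice of \<open>\<epsilon>\<close>.\<close>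
  then have "\<eta> \<le> infdist p (fun_graph f)"
    using pos[of p] K \<open>p \<in> K\<close> \<eta>(1) by (auto simp: g_def)
  also have "\<dots> \<le> dist p (a + m *\<^sub>R v, f (a + m *\<^sub>R v))"
    by (intro infdist_le) (auto simp: fun_graph_def)
  also have "\<dots> = \<epsilon> / norm w"
    unfolding p_def dist_Pair_Pair using \<epsilon>(1) by (simp only: dist_norm add_diff_cancel_left' nw) simp
  also have "\<dots> < \<eta>"
    using \<epsilon>(2) \<open>w \<noteq> 0\<close> by (simp add: field_simps)
  finally show False by simp
qed

theorem theorem5p13:
  fixes f :: "real ^ 'n \<Rightarrow> real ^ 'k"
  assumes "continuous_on UNIV f"
  shows "affine_linear_on UNIV f \<longleftrightarrow>
    real_q_convex_set (CARD('k) - 1) (- fun_graph f)"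
  using real_q_convex_set_Compl_graph_affine[of f]
    affine_linear_on_if_real_q_convex_set_Compl_graph[OF assms] by auto

end
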